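(* Let $N\ge 3$ and $0\le n\le N$. (1) The two self maps $Bav$ and $Btr$ of $\mathbf{B}_N^n$ commute with each other: $Btr\circ Bav=Bav\circ Btr$. (2) For any $i\in\mathbf{Z}_N$, let $Bav_N^i=pr_i\circ Bav:\mathbf{B}_N^n\to\mathbf{F}_2$, where $pr_i:\mathbf{F}_2^N\to\mathbf{F}_2$ is the projection onto the $i$-th factor. Then $$Btr^*(Bav_N^i)=Bav_N^{i-_N1},$$ where $Btr^*(Bav_N^i)=Bav_N^i\circ Btr$ is the pull-back of $Bav_N^i$ through the self map $Btr$ on $\mathbf{B}_N^n$.
   Context: Let $N\ge 3$ and $\mathbf{Z}_N=\{0,1,\dots,N-1\}$. For an integer $m$, $\langle m\rangle_N\in\mathbf{Z}_N$ is its least nonnegative remainder modulo $N$; $a+_Nb=\langle a+b\rangle_N$, $a-_Nb=\langle a-b\rangle_N$. For $a,b\in\mathbf{Z}_N$ put $av_{\mathbf{Z}_N}(a,b)=a+_N\left\lfloor\frac{b-_Na}{2}\right\rfloor$. $\mathbf{B}_N=\mathbf{F}_2^N$, with coordinates indexed by $\mathbf{Z}_N$, and $\mathbf{B}_N^n$ is the set of $\mathbf{v}\in\mathbf{B}_N$ having exactly $n$ coordinates equal to $1$. Boolean average. For $\mathbf{v}=(v_0,\dots,v_{N-1})\in\mathbf{B}_N^n$ let $a_0<a_1<\dots<a_{n-1}$ be the elements of $\{i\in\mathbf{Z}_N: v_i=1\}$ in increasing order. $Bav(\mathbf{v})$ is the vector whose $i$-th coordinate is $1$ exactly when $i=av_{\mathbf{Z}_N}(a_k,a_{k+1})$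 for some $0\le k\le n-1$, where $a_n:=a_0$ (so $Bav(\mathbf 0)=\mathbf 0$, and $Bav(\mathbf v)=\mathbf v$ if $n=1$). This defines a map $Bav:\mathbf{B}_N^n\to\mathbf{B}_N^n$. Cyclic shift. $Btr(v_0,v_1,\dots,v_{N-1})=(v_{N-1},v_0,v_1,\dots,v_{N-2})$; it maps $\mathbf{B}_N^n$ to itself. *)

theory Defs
  imports Main "HOL-Library.FuncSet" "HOL-Library.Z2"
begin

definition ZN :: "int \<Rightarrow> int set" where
  "ZN N = {0..<N}"

text \<open>For \<open>N > 0\<close>, \<open>m mod N\<close> on integers is the least nonnegative remainder.\<close>

definition addN :: "int \<Rightarrow> int \<Rightarrow> int \<Rightarrow> int" where
  "addN N a b = (a + b) mod N"

definition subN :: "int \<Rightarrow> int \<Rightarrow> int \<Rightarrow> int" where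
  "subN N a b = (a - b) mod N"

text \<open>Integer \<open>div\<close> rounds down, so \<open>x div 2\<close> is the floor of \<open>x/2\<close>.\<close>

definition avN :: "int \<Rightarrow> int \<Rightarrow> int \<Rightarrow> int" where
  "avN N a b = addN N a (subN N b a div 2)"

text \<open>A vector over the two-element field \<open>bit\<close> is an extensional function on
  \<open>ZN N\<close>, so HOL equality of such functions is equality of vectors.\<close>

definition BN :: "int \<Rightarrow> (int \<Rightarrow> bit) set" where
  "BN N = ZN N \<rightarrow>\<^sub>E UNIV"

definition ones :: "int \<Rightarrow> (int \<Rightarrow> bit) \<Rightarrow> int set" where
  "ones N v = {i \<in> ZN N. v i = 1}"

definition BNn :: "int \<Rightarrow> nat \<Rightarrow> (int \<Rightarrow> bit) set" where
  "BNn N n = {v \<in> BN N. card (ones N v) = n}"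

text \<open>With \<open>as = [a\<^sub>0, \<dots>, a\<^bsub>n-1\<^esub>]\<close>, the index \<open>Suc k mod n\<close> expresses the
  convention that \<open>a\<^sub>n\<close> is \<open>a\<^sub>0\<close>.\<close>

definition Bav :: "int \<Rightarrow> (int \<Rightarrow> bit) \<Rightarrow> (int \<Rightarrow> bit)" where
  "Bav N v =
    (let as = sorted_list_of_set (ones N v); n = length as
     in (\<lambda>i\<in>ZN N. if \<exists>k<n. i = avN N (as ! k) (as ! (Suc k mod n)) then 1 else 0))"

definition Btr :: "int \<Rightarrow> (int \<Rightarrow> bit) \<Rightarrow> (int \<Rightarrow> bit)" where
  "Btr N v = (\<lambda>i\<in>ZN N. if i = 0 then v (N - 1) else v (i - 1))"

definition pr :: "int \<Rightarrow> (int \<Rightarrow> bit) \<Rightarrow> bit" where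
  "pr i v = v i"

text \<open>\<open>compose A g f\<close> is the composite of \<open>g\<close> and \<open>f\<close> as a map with domain
  exactly \<open>A\<close> (\<open>undefined\<close> elsewhere). So \<open>Bav_coord N n i\<close> is a map on
  \<open>BNn N n\<close> only, and equality of two such maps is equality of functions on
  \<open>BNn N n\<close>.\<close>

definition Bav_coord :: "int \<Rightarrow> nat \<Rightarrow> int \<Rightarrow> (int \<Rightarrow> bit) \<Rightarrow> bit" where
  "Bav_coord N n i = compose (BNn N n) (pr i) (Bav N)"

definition Btr_pullback ::
    "int \<Rightarrow> nat \<Rightarrow> ((int \<Rightarrow> bit) \<Rightarrow> bit) \<Rightarrow> (int \<Rightarrow> bit) \<Rightarrow> bit" where
  "Btr_pullback N n f = compose (BNn N n) f (Btr N)"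

end

theory Submission
  imports Defs
begin

text \<open>
  The averages of cyclically consecutive entries of a list do not change as a set when the list is
  rotated, and they commute with translations modulo \<open>N\<close>. The shift \<open>Btr\<close> translates the
  support by one modulo \<open>N\<close>, which turns its increasing enumeration into a rotation of the
  translated enumeration; hence \<open>Bav\<close> and \<open>Btr\<close> commute. Since
  \<open>a\<^sub>k \<le> av(a\<^sub>k, a\<^bsub>k+1\<^esub>) < a\<^bsub>k+1\<^esub>\<close> around the circle, starting from \<open>a\<^sub>0\<close>, the averages are
  pairwise distinct, so \<open>Bav\<close> preserves the number of ones.
\<close>

section \<open>Functions of cyclically consecutive list entries\<close>

definition cyclic_map2 :: "('a \<Rightarrow> 'a \<Rightarrow> 'b) \<Rightarrow> 'a list \<Rightarrow> 'b list" where
  "cyclic_map2 f xs = map2 f xs (rotate1 xs)"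

lemma length_cyclic_map2 [simp]: "length (cyclic_map2 f xs) = length xs"
  by (simp add: cyclic_map2_def)

lemma nth_cyclic_map2:
  "k < length xs \<Longrightarrow> cyclic_map2 f xs ! k = f (xs ! k) (xs ! (Suc k mod length xs))"
  by (simp add: cyclic_map2_def nth_rotate1)

lemma set_cyclic_map2:
  "set (cyclic_map2 f xs) = {f (xs ! k) (xs ! (Suc k mod length xs)) | k. k < length xs}"
  by (force simp: set_conv_nth nth_cyclic_map2)

text \<open>Both sides use the entries one and two places after \<open>k\<close>, cyclically. Hence
  the set of values does not depend on where the enumeration of the circle starts.\<close>

lemma cyclic_map2_rotate1: "cyclic_map2 f (rotate1 xs) = rotate1 (cyclic_map2 f xs)"
proof (rule nth_equalityI)
  fix k assume "k < length (cyclic_map2 f (rotate1 xs))"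
  then have k: "k < length xs" by simp
  then have "Suc k mod length xs < length xs" by (intro mod_less_divisor) linarith
  with k show "cyclic_map2 f (rotate1 xs) ! k = rotate1 (cyclic_map2 f xs) ! k"
    by (simp add: nth_cyclic_map2 nth_rotate1)
qed simp

lemma cyclic_map2_map:
  assumes "\<And>x y. f (g x) (g y) = h (f x y)"
  shows "cyclic_map2 f (map g xs) = map h (cyclic_map2 f xs)"
proof (rule nth_equalityI)
  fix k assume "k < length (cyclic_map2 f (map g xs))"
  then have k: "k < length xs" by simp
  then have "Suc k mod length xs < length xs" by (intro mod_less_divisor) linarith
  with k show "cyclic_map2 f (map g xs) ! k = map h (cyclic_map2 f xs) ! k"
    by (simp add: nth_cyclic_map2 assms)
qed simp

text \<open>The cyclic gap \<open>subN N b a\<close> is translation invariant, hence so is its half;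
  only the base point moves.\<close>

lemma avN_addN: "avN N (addN N a c) (addN N b c) = addN N (avN N a b) c"
proof -
  have "subN N (addN N b c) (addN N a c) = subN N b a"
    by (simp add: subN_def addN_def mod_diff_eq)
  then show ?thesis
    by (simp add: avN_def addN_def mod_simps algebra_simps)
qed

section \<open>Vectors and their supports\<close>

lemma finite_ones [simp]: "finite (ones N v)"
  by (rule finite_subset [of _ "{0..<N}"]) (auto simp: ones_def ZN_def)

lemma ones_subset: "ones N v \<subseteq> {0..<N}"
  by (auto simp: ones_def ZN_def)

lemma BN_eqI:
  assumes "u \<in> BN N" "w \<in> BN N" "ones N u = ones N w"
  shows "u = w"
proof (rule extensionalityI)
  show "u \<in> extensional (ZN N)" "w \<in> extensional (ZN N)"
    using assms(1,2) by (auto simp: BN_def PiE_def)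
  fix i assume i: "i \<in> ZN N"
  with assms(3) have "u i = 1 \<longleftrightarrow> w i = 1" by (auto simp: ones_def)
  then show "u i = w i" by (metis bit_not_one_iff)
qed

lemma Bav_in_BN: "Bav N v \<in> BN N"
  by (auto simp: Bav_def BN_def Let_def)

lemma Btr_in_BN: "Btr N v \<in> BN N"
  by (auto simp: Btr_def BN_def)

lemma ones_Bav:
  assumes "N > 0"
  shows "ones N (Bav N v) = set (cyclic_map2 (avN N) (sorted_list_of_set (ones N v)))"
proof -
  \<comment> \<open>The restriction to \<open>ZN N\<close> in \<open>Bav\<close> therefore loses no
    average.\<close>
  have "avN N a b \<in> ZN N" for a b using assms by (simp add: avN_def addN_def ZN_def)
  then show ?thesis
    unfolding ones_def [of N "Bav N v"] set_cyclic_map2 by (auto simp: Bav_def Let_def)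
qed

text \<open>Residues absorb the wrap-around at \<open>i = 0\<close>, since
  \<open>-1 mod N = N - 1\<close>.\<close>

lemma Btr_apply:
  assumes "i \<in> ZN N"
  shows "Btr N v i = v (subN N i 1)"
proof (cases "i = 0")
  case True
  with assms show ?thesis
    by (simp add: Btr_def subN_def ZN_def zmod_minus1)
next
  case False
  with assms show ?thesis
    by (simp add: Btr_def subN_def ZN_def mod_pos_pos_trivial)
qed

lemma ones_Btr:
  assumes "N > 0"
  shows "ones N (Btr N v) = (\<lambda>x. addN N x 1) ` ones N v"
proof (intro equalityI subsetI)
  fix i assume "i \<in> ones N (Btr N v)"
  then have "i \<in> ZN N" "v (subN N i 1) = 1" by (auto simp: ones_def Btr_apply)
  then have "subN N i 1 \<in> ones N v" "i = addN N (subN N i 1) 1"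
    using assms by (auto simp: ones_def ZN_def subN_def addN_def mod_simps)
  then show "i \<in> (\<lambda>x. addN N x 1) ` ones N v" by blast
next
  fix i assume "i \<in> (\<lambda>x. addN N x 1) ` ones N v"
  then obtain x where x: "x \<in> ZN N" "v x = 1" "i = addN N x 1" by (auto simp: ones_def)
  then have "i \<in> ZN N" "subN N i 1 = x"
    using assms by (auto simp: ZN_def subN_def addN_def mod_simps)
  with x show "i \<in> ones N (Btr N v)" by (simp add: ones_def Btr_apply)
qed

section \<open>Translation by one and the increasing enumeration\<close>

lemma inj_on_addN: "inj_on (\<lambda>x. addN N x c) {0..<N}"
proof (rule inj_on_inverseI)
  fix x assume "x \<in> {0..<N}"
  then show "subN N (addN N x c) c = x" by (simp add: subN_def addN_def mod_simps)
qed

text \<open>Only \<open>N - 1\<close> wraps around. If it is absent, the translation preserves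
  order; if present, it is enumerated last, while its image \<open>0\<close> comes first in the new
  enumeration.\<close>

lemma sorted_list_of_set_shift:
  assumes S: "S \<subseteq> {0..<N}"
  defines "xs \<equiv> map (\<lambda>x. addN N x 1) (sorted_list_of_set S)"
    and "ys \<equiv> sorted_list_of_set ((\<lambda>x. addN N x 1) ` S)"
  shows "xs = ys \<or> xs = rotate1 ys"
proof -
  have fin: "finite S" using S finite_subset by blast
  show ?thesis
  proof (cases "N - 1 \<in> S")
    case False
    have sh: "addN N x 1 = x + 1" if "x \<in> S" for x
    proof -
      have "0 \<le> x" "x < N" "x \<noteq> N - 1" using S that False by auto
      then show ?thesis by (simp add: addN_def)
    qed
    have "xs = map (\<lambda>x. x + 1) (sorted_list_of_set S)"
      using fin sh by (simp add: xs_def)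
    moreover have "ys = map (\<lambda>x. x + 1) (sorted_list_of_set S)"
      unfolding ys_def
    \<comment> \<open>A strictly increasing list is determined by its set of entries.\<close>
    proof (rule strict_sorted_equal)
      show "sorted_wrt (<) (map (\<lambda>x. x + 1) (sorted_list_of_set S))"
        unfolding sorted_wrt_map
        by (rule sorted_wrt_mono_rel [OF _ strict_sorted_list_of_set]) simp
      show "set (sorted_list_of_set ((\<lambda>x. addN N x 1) ` S)) =
          set (map (\<lambda>x. x + 1) (sorted_list_of_set S))"
        using fin sh by auto
    qed simp
    ultimately show ?thesis by simp
  next
    case True
    define T where "T = S - {N - 1}"
    have T: "finite T" "S = insert (N - 1) T" "T \<subseteq> {0..<N - 1}"
      using S True fin by (force simp: T_def)+
    have sh: "addN N x 1 = x + 1" if "x \<in> T" for x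
      using T(3) that by (auto simp: addN_def)
    have "sorted_list_of_set S = sorted_list_of_set T @ [N - 1]"
    proof (rule strict_sorted_equal)
      show "sorted_wrt (<) (sorted_list_of_set T @ [N - 1])"
        using T by (auto simp: sorted_wrt_append)
      show "set (sorted_list_of_set S) = set (sorted_list_of_set T @ [N - 1])"
        using T(1) fin by (simp flip: T(2))
    qed simp
    then have "xs = map (\<lambda>x. x + 1) (sorted_list_of_set T) @ [0]"
      using T(1) sh by (simp add: xs_def addN_def)
    moreover have "ys = 0 # map (\<lambda>x. x + 1) (sorted_list_of_set T)"
      unfolding ys_def
    proof (rule strict_sorted_equal)
      have "sorted_wrt (<) (map (\<lambda>x. x + 1) (sorted_list_of_set T))"
        unfolding sorted_wrt_map
        by (rule sorted_wrt_mono_rel [OF _ strict_sorted_list_of_set]) simp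
      then show "sorted_wrt (<) (0 # map (\<lambda>x. x + 1) (sorted_list_of_set T))"
        using T by auto
      have "(\<lambda>x. addN N x 1) ` S = insert 0 ((\<lambda>x. x + 1) ` T)"
        unfolding T(2) using sh by (auto simp: addN_def)
      moreover have "finite ((\<lambda>x. addN N x 1) ` S)" using fin by simp
      ultimately show "set (sorted_list_of_set ((\<lambda>x. addN N x 1) ` S)) =
          set (0 # map (\<lambda>x. x + 1) (sorted_list_of_set T))"
        using T(1) by (metis set_sorted_list_of_set list.simps(15) set_map)
    qed simp
    ultimately show ?thesis by simp
  qed
qed

lemma ones_Bav_Btr:
  assumes "N > 0"
  shows "ones N (Bav N (Btr N v)) = ones N (Btr N (Bav N v))"
proof -
  let ?s = "\<lambda>x. addN N x 1"
  let ?as = "sorted_list_of_set (ones N v)"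
  let ?bs = "sorted_list_of_set (?s ` ones N v)"
  \<comment> \<open>The two lists agree up to one rotation, which only rotates the list of
    averages.\<close>
  have "set (cyclic_map2 (avN N) ?bs) = set (cyclic_map2 (avN N) (map ?s ?as))"
    using sorted_list_of_set_shift [OF ones_subset, of N v]
    by (metis cyclic_map2_rotate1 set_rotate1)
  also have "\<dots> = ?s ` set (cyclic_map2 (avN N) ?as)"
    using cyclic_map2_map [of "avN N" ?s ?s] avN_addN by simp
  finally show ?thesis
    using assms by (simp add: ones_Bav ones_Btr)
qed

section \<open>Distinctness of the averages and the number of ones\<close>

lemma distinct_cyclic_map2_avN:
  assumes sorted: "sorted_wrt (<) as" and sub: "set as \<subseteq> {0..<N}"
  shows "distinct (cyclic_map2 (avN N) as)"
\<comment> \<open>A single entry is treated apart: its gap to itself is \<open>0\<close> in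
  \<open>subN\<close>, but would be a full turn \<open>N\<close> in the lift below.\<close>
proof (cases "length as \<le> 1")
  case True
  then have "length (cyclic_map2 (avN N) as) \<le> 1" by simp
  then show ?thesis by (cases "cyclic_map2 (avN N) as") auto
next
  case False
  define n where "n = length as"
  have n: "n \<ge> 2" using False by (simp add: n_def)
  \<comment> \<open>Lift to the integers: index \<open>n\<close> is the return to
    \<open>as ! 0\<close> one turn later, and \<open>m k\<close> is the average before reduction
    modulo \<open>N\<close>.\<close>
  define c where "c k = (if k < n then as ! k else as ! 0 + N)" for k
  define m where "m k = c k + (c (Suc k) - c k) div 2" for k
  have rng: "0 \<le> as ! k" "as ! k < N" if "k < n" for k
    using subsetD [OF sub nth_mem [of k as]] that by (simp_all add: n_def)
  have less: "as ! j < as ! k" if "j < k" "k < n" for j k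
    using sorted that by (simp add: sorted_wrt_iff_nth_less n_def)
  have c_less: "c k < c (Suc k)" if "k < n" for k
    using that less [of k "Suc k"] rng [of k] rng [of 0] n by (auto simp: c_def)
  \<comment> \<open>The floor of half a positive gap is nonnegative and strictly less than the
    gap.\<close>
  have m: "c k \<le> m k" "m k < c (Suc k)" if "k < n" for k
    using c_less [OF that] by (auto simp: m_def)
  have c_mono: "c j \<le> c k" if "j \<le> k" "k \<le> n" for j k
    using that(1) that(2)
  proof (induction rule: dec_induct)
    case (step i)
    then show ?case using c_less [of i] by simp
  qed simp
  have av: "cyclic_map2 (avN N) as ! k = m k mod N" if k: "k < n" for k
  proof -
    have gap: "subN N (as ! (Suc k mod n)) (as ! k) = c (Suc k) - c k"
    proof (cases "Suc k < n")
      case True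
      then show ?thesis
        using less [of k "Suc k"] rng [of k] rng [of "Suc k"]
        by (simp add: subN_def c_def)
    next
      case False
      then have Suc: "Suc k = n" using k by simp
      \<comment> \<open>Since \<open>n \<ge> 2\<close>, the last index is not \<open>0\<close>; so
        the difference is negative, and adding \<open>N\<close> makes it its own residue.\<close>
      have "as ! 0 < as ! k" using less [of 0 k] k n Suc by simp
      then have "(as ! 0 - as ! k + N) mod N = as ! 0 - as ! k + N"
        using rng [of 0] rng [of k] k n by (intro mod_pos_pos_trivial) auto
      then have "(as ! 0 - as ! k) mod N = as ! 0 - as ! k + N" by simp
      then show ?thesis using k Suc by (simp add: subN_def c_def)
    qed
    have "cyclic_map2 (avN N) as ! k = avN N (as ! k) (as ! (Suc k mod n))"
      using k by (simp add: nth_cyclic_map2 n_def)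
    also have "\<dots> = m k mod N"
      unfolding avN_def gap addN_def m_def using k by (simp add: c_def)
    finally show ?thesis .
  qed
  have neq: "m j mod N \<noteq> m k mod N" if "j < k" "k < n" for j k
  proof
    assume "m j mod N = m k mod N"
    then have dvd: "N dvd m k - m j" by (metis mod_eq_dvd_iff)
    have "m j < m k"
      using m [of j] m [of k] c_mono [of "Suc j" k] that by simp
    \<comment> \<open>All lifted averages lie in the half-open window from \<open>c 0\<close> to
      \<open>c 0 + N\<close>, where distinct integers have distinct residues.\<close>
    moreover have "m k - m j < N"
    proof -
      have "c 0 \<le> m j" using m [of j] c_mono [of 0 j] that by simp
      moreover have "m k < c n" using m [of k] c_mono [of "Suc k" n] that by simp
      moreover have "c n = c 0 + N" using n by (simp add: c_def)
      ultimately show ?thesis by simp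
    qed
    ultimately show False using zdvd_imp_le [OF dvd] by simp
  qed
  show ?thesis
    unfolding distinct_conv_nth
    by (metis av neq length_cyclic_map2 n_def linorder_neqE_nat)
qed

lemma card_ones_Bav:
  assumes "N > 0"
  shows "card (ones N (Bav N v)) = card (ones N v)"
proof -
  have "distinct (cyclic_map2 (avN N) (sorted_list_of_set (ones N v)))"
    using ones_subset by (intro distinct_cyclic_map2_avN) simp_all
  then show ?thesis
    using assms by (simp add: ones_Bav distinct_card)
qed

lemma card_ones_Btr:
  assumes "N > 0"
  shows "card (ones N (Btr N v)) = card (ones N v)"
  using assms inj_on_subset [OF inj_on_addN ones_subset]
  by (simp add: ones_Btr card_image)

theorem theorem3p1:
  fixes N :: int and n :: nat
  assumes "N \<ge> 3" and "int n \<le> N"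
  shows "Bav N \<in> BNn N n \<rightarrow> BNn N n
    \<and> Btr N \<in> BNn N n \<rightarrow> BNn N n
    \<and> compose (BNn N n) (Btr N) (Bav N) = compose (BNn N n) (Bav N) (Btr N)
    \<and> (\<forall>i\<in>ZN N. Btr_pullback N n (Bav_coord N n i) = Bav_coord N n (subN N i 1))"
proof -
  have N: "N > 0" using assms(1) by simp
  have Bav: "Bav N \<in> BNn N n \<rightarrow> BNn N n"
    using N by (auto simp: BNn_def Bav_in_BN card_ones_Bav)
  have Btr: "Btr N \<in> BNn N n \<rightarrow> BNn N n"
    using N by (auto simp: BNn_def Btr_in_BN card_ones_Btr)
  have comm: "Btr N (Bav N v) = Bav N (Btr N v)" for v
    using N by (intro BN_eqI [of _ N]) (simp_all add: Btr_in_BN Bav_in_BN ones_Bav_Btr)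
  \<comment> \<open>This is the commutation read at coordinate \<open>i\<close>, where
    \<open>Btr\<close> fetches coordinate \<open>subN N i 1\<close>.\<close>
  have "Btr_pullback N n (Bav_coord N n i) = Bav_coord N n (subN N i 1)" if "i \<in> ZN N" for i
    unfolding Btr_pullback_def Bav_coord_def compose_def
  proof (rule restrict_ext)
    fix v assume "v \<in> BNn N n"
    \<comment> \<open>The coordinate map is \<open>undefined\<close> off \<open>BNn N n\<close>, so
      its argument must be known to lie there.\<close>
    with Btr have "Btr N v \<in> BNn N n" by blast
    then show "(\<lambda>x\<in>BNn N n. pr i (Bav N x)) (Btr N v) = pr (subN N i 1) (Bav N v)"
      using that by (simp add: pr_def Btr_apply flip: comm)
  qed
  with Bav Btr comm show ?thesis by (auto simp: compose_def)
qed

end
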